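(* Let $G$ be a graph and let $n,m$ be integers with $0 < n \leq m \leq 2n$. If $\mathrm{iso}(G-S)\le \frac{m}{n}|S|$ for all subsets $S\subseteq V(G)$, then (i) $\min(G, K_{1,2})\le \frac{m-n}{m+n} |V(G)|$, and (ii) $\alpha(G)\le \frac{m}{m+n} |V(G)|$.
   Context: All graphs are finite and simple. $G-S$ is the subgraph induced by $V(G)\setminus S$, and $\mathrm{iso}(H)$ is the number of isolated vertices of $H$. $K_{1,i}$ is the star with $i$ edges and $C_k$ is the circuit on $k$ vertices. A $\{K_{1,1}, K_{1,2}, C_k : k\ge 3\}$-factor of $G$ is a spanning subgraph each of whose components is isomorphic to $K_{1,1}$, $K_{1,2}$, or $C_k$ for some $k\ge 3$. $\min(G,K_{1,2})$ denotes the minimum, over all $\{K_{1,1}, K_{1,2}, C_k : k\ge 3\}$-factors $F$ of $G$, of the number of components of $F$ isomorphic to $K_{1,2}$ (by a theorem of Akiyama and Era, $G$ has such a factor if and only if $\mathrm{iso}(G-S)\le 2|S|$ for all $S\subseteq V(G)$, so under the hypothesis this minimum is defined). $\alpha(G)$ is the maximum cardinality of an independent set of vertices. *)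

theory Defs
  imports "Graph_Theory.Graph_Theory"
begin

text \<open>
  A finite simple graph is a \<^locale>\<open>pair_graph\<close>: a finite vertex set with a symmetric, irreflexive
  set of ordered pairs, each edge being represented by its two orientations. Since all digraphs
  below are symmetric, their strongly connected components (\<open>pre_digraph.sccs\<close>) are the connected
  components of the undirected graph.
\<close>

definition num_isolated :: "('a, 'b) pre_digraph \<Rightarrow> nat" where
  "num_isolated H = card {v \<in> verts H. \<forall>u \<in> verts H. \<not> v \<rightarrow>\<^bsub>H\<^esub> u}"

definition delete_verts :: "'a pair_pre_digraph \<Rightarrow> 'a set \<Rightarrow> ('a, 'a \<times> 'a) pre_digraph" where
  "delete_verts G S = with_proj G \<restriction> (pverts G - S)"

definition independent_set :: "'a pair_pre_digraph \<Rightarrow> 'a set \<Rightarrow> bool" where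
  "independent_set G I \<longleftrightarrow> I \<subseteq> pverts G \<and> (\<forall>u \<in> I. \<forall>v \<in> I. (u, v) \<notin> parcs G)"

definition independence_number :: "'a pair_pre_digraph \<Rightarrow> nat" where
  "independence_number G = Max {card I |I. independent_set G I}"

text \<open>The circuit on \<open>k\<close> vertices; it is a simple graph for \<open>k \<ge> 3\<close> only.\<close>

definition circuit_graph :: "nat \<Rightarrow> nat pair_pre_digraph" where
  "circuit_graph k = \<lparr> pverts = {0..<k},
     parcs = {(i, (i + 1) mod k) |i. i < k} \<union> {((i + 1) mod k, i) |i. i < k} \<rparr>"

text \<open>
  \<open>K\<^bsub>1,i\<^esub> C\<close> is the library's \<^const>\<open>complete_bipartite_digraph\<close>, which says that \<open>C\<close> is a complete
  bipartite graph with parts of sizes \<open>1\<close> and \<open>i\<close>, i.e. isomorphic to the star with \<open>i\<close> edges.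
  \<^const>\<open>spanning\<close> alone would allow \<open>F\<close> to keep just one orientation of an edge; this is
  excluded by requiring \<open>F\<close> to be a graph itself.
\<close>

definition star_circuit_factor :: "'a pair_pre_digraph \<Rightarrow> 'a pair_pre_digraph \<Rightarrow> bool" where
  "star_circuit_factor G F \<longleftrightarrow>
     pair_graph F \<and> spanning (with_proj F) (with_proj G) \<and>
     (\<forall>C \<in> pre_digraph.sccs (with_proj F).
        K\<^bsub>1,1\<^esub> C \<or> K\<^bsub>1,2\<^esub> C \<or> (\<exists>k \<ge> 3. digraph_iso C (with_proj (circuit_graph k))))"

definition num_K12_components :: "'a pair_pre_digraph \<Rightarrow> nat" where
  "num_K12_components F = card {C \<in> pre_digraph.sccs (with_proj F). K\<^bsub>1,2\<^esub> C}"

text \<open>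
  For a graph without such a factor, the \<^term>\<open>Least\<close> is over an empty set and hence unspecified,
  so no bound on it is provable without exhibiting a factor.
\<close>

definition min_K12 :: "'a pair_pre_digraph \<Rightarrow> nat" where
  "min_K12 G = (LEAST t. \<exists>F. star_circuit_factor G F \<and> num_K12_components F = t)"

end

theory Submission
  imports Defs
begin

text \<open>
  A set \<open>P\<close> of arcs of \<open>G\<close> in which every vertex has at most one successor and at most one
  predecessor is a matching of the bipartite double cover of \<open>G\<close>; it splits \<open>G\<close> into directed
  paths and cycles. If every vertex is incident with \<open>P\<close>, then no path is trivial, and cutting the
  paths into edges, with one \<open>K\<^bsub>1,2\<^esub>\<close> for each path of odd order, gives a factor in which the number of
  \<open>K\<^bsub>1,2\<^esub>\<close> is at most the number of paths, \<open>|V| - |P|\<close>.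

  By Hall's theorem, \<open>iso(G - S) \<le> 2|S|\<close> yields \<open>f : V \<rightarrow> V\<close> along edges with fibres of size at
  most two, that is, \<open>V = A \<union> B\<close> with both \<open>A\<close> and \<open>B\<close> matchable, and \<open>iso(G - S) \<le> |S| + d\<close> yields
  a matching of size at least \<open>|V| - d\<close>. Two applications of the Mendelsohn--Dulmage theorem give
  a matching of this size covering \<open>A\<close> on the left and \<open>B\<close> on the right, hence every vertex.
  Finally, \<open>n|X| \<le> m|S|\<close> and \<open>|X| + |S| \<le> |V|\<close> imply \<open>|X| - |S| \<le> (m - n)/(m + n) |V|\<close>.
\<close>

section \<open>Matchings as relations\<close>

text \<open>Induction on \<open>I\<close> after Halmos and Vaughan. Either some nonempty proper
  subset \<open>J\<close> is tight, and \<open>J\<close> and \<open>I - J\<close> are matched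
  separately, or every such subset has a surplus, and one element may be matched
  arbitrarily.\<close>

theorem hall_marriage:
  assumes "finite I" and "\<And>i. i \<in> I \<Longrightarrow> finite (A i)"
    and "\<And>J. J \<subseteq> I \<Longrightarrow> card J \<le> card (\<Union> (A ` J))"
  shows "\<exists>f. inj_on f I \<and> (\<forall>i\<in>I. f i \<in> A i)"
  using assms
proof (induction I arbitrary: A rule: finite_psubset_induct)
  case (psubset I)
  note fin = psubset.prems(1) and hall = psubset.prems(2)
  consider "I = {}"
    | J where "J \<subset> I" "J \<noteq> {}" "card J = card (\<Union> (A ` J))"
    | "I \<noteq> {}" "\<And>J. J \<subset> I \<Longrightarrow> J \<noteq> {} \<Longrightarrow> card J < card (\<Union> (A ` J))"
    by (metis psubset_imp_subset hall order_le_less)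
  then show ?case
  proof cases
    case 1
    then show ?thesis by simp
  next
    case (2 J)
    have "\<exists>f. inj_on f J \<and> (\<forall>i\<in>J. f i \<in> A i)"
    proof (rule psubset.IH)
      show "J \<subset> I" by fact
      show "finite (A i)" if "i \<in> J" for i using that fin 2(1) by blast
      show "card K \<le> card (\<Union> (A ` K))" if "K \<subseteq> J" for K using that hall 2(1) by simp
    qed
    then obtain f where f: "inj_on f J" "\<And>i. i \<in> J \<Longrightarrow> f i \<in> A i" by blast
    define B where "B i = A i - \<Union> (A ` J)" for i
    \<comment> \<open>Hall's condition for \<open>K \<union> J\<close>, minus the equality for the
      tight set \<open>J\<close>, is Hall's condition for \<open>K\<close> once the values available
      to \<open>J\<close> are removed.\<close>
    have "card K \<le> card (\<Union> (B ` K))" if K: "K \<subseteq> I - J" for K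
    proof -
      have fJ: "finite J" "finite K" using 2 K \<open>finite I\<close> by (auto intro: finite_subset)
      have "card K + card J = card (K \<union> J)"
        using K fJ by (subst card_Un_disjoint) auto
      also have "\<dots> \<le> card (\<Union> (A ` (K \<union> J)))" using K 2 by (intro hall) auto
      also have "\<Union> (A ` (K \<union> J)) = \<Union> (B ` K) \<union> \<Union> (A ` J)" by (auto simp: B_def)
      also have "card \<dots> \<le> card (\<Union> (B ` K)) + card (\<Union> (A ` J))" by (rule card_Un_le)
      finally show ?thesis using 2 by simp
    qed
    then have "\<exists>g. inj_on g (I - J) \<and> (\<forall>i\<in>I - J. g i \<in> B i)"
      using 2(1,2) fin by (intro psubset.IH) (auto simp: B_def)
    then obtain g where g: "inj_on g (I - J)" "\<And>i. i \<in> I - J \<Longrightarrow> g i \<in> B i" by blast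
    let ?h = "\<lambda>i. if i \<in> J then f i else g i"
    have "inj_on ?h I"
    proof (rule inj_onI)
      fix x y assume xy: "x \<in> I" "y \<in> I" "?h x = ?h y"
      have "f a \<noteq> g b" if "a \<in> J" "b \<in> I - J" for a b
        using f(2)[of a] g(2)[of b] that by (auto simp: B_def)
      with xy f(1) g(1) show "x = y" by (auto split: if_splits simp: inj_on_def dest: sym)
    qed
    moreover have "\<forall>i\<in>I. ?h i \<in> A i" using f g by (auto simp: B_def)
    ultimately show ?thesis by blast
  next
    case 3
    then obtain i where i: "i \<in> I" by blast
    have "A i \<noteq> {}" using hall[of "{i}"] i by auto
    then obtain a where a: "a \<in> A i" by blast
    define B where "B j = A j - {a}" for j
    \<comment> \<open>Removing \<open>a\<close> costs at most one value, which the strict inequality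
      of this case pays for.\<close>
    have "card K \<le> card (\<Union> (B ` K))" if K: "K \<subseteq> I - {i}" for K
    proof (cases "K = {}")
      case False
      have "\<Union> (B ` K) = \<Union> (A ` K) - {a}" by (auto simp: B_def)
      moreover have "card K < card (\<Union> (A ` K))" using 3(2)[of K] K i False by blast
      moreover have "card (\<Union> (A ` K)) - 1 \<le> card (\<Union> (A ` K) - {a})"
        by (simp add: card_Diff_singleton_if)
      ultimately show ?thesis by simp
    qed simp
    then have "\<exists>g. inj_on g (I - {i}) \<and> (\<forall>j\<in>I - {i}. g j \<in> B j)"
      using i fin by (intro psubset.IH) (auto simp: B_def)
    then obtain g where g: "inj_on g (I - {i})" "\<And>j. j \<in> I - {i} \<Longrightarrow> g j \<in> B j" by blast
    let ?h = "g(i := a)"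
    have "inj_on ?h I"
      using g by (auto simp: inj_on_def B_def)
    moreover have "\<forall>j\<in>I. ?h j \<in> A j" using g a by (auto simp: B_def)
    ultimately show ?thesis by blast
  qed
qed

definition matching :: "('a \<times> 'b) set \<Rightarrow> bool" where
  "matching M \<longleftrightarrow> single_valued M \<and> single_valued (M\<inverse>)"

lemma matchingI:
  assumes "\<And>a b b'. (a, b) \<in> M \<Longrightarrow> (a, b') \<in> M \<Longrightarrow> b = b'"
    and "\<And>a a' b. (a, b) \<in> M \<Longrightarrow> (a', b) \<in> M \<Longrightarrow> a = a'"
  shows "matching M"
  unfolding matching_def single_valued_def using assms by blast

lemma matchingD:
  assumes "matching M"
  shows "(a, b) \<in> M \<Longrightarrow> (a, b') \<in> M \<Longrightarrow> b = b'" and "(a, b) \<in> M \<Longrightarrow> (a', b) \<in> M \<Longrightarrow> a = a'"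
  using assms unfolding matching_def single_valued_def by blast+

lemma matching_converse: "matching (M\<inverse>) \<longleftrightarrow> matching M"
  by (auto simp: matching_def)

lemma matching_subset: "matching M \<Longrightarrow> N \<subseteq> M \<Longrightarrow> matching N"
  by (auto intro!: matchingI dest: matchingD)

lemma matching_card_Domain: "matching M \<Longrightarrow> card (Domain M) = card M"
  unfolding fst_eq_Domain[symmetric] by (intro card_image inj_onI) (auto dest: matchingD)

lemma matching_card_Range: "matching M \<Longrightarrow> card (Range M) = card M"
  unfolding snd_eq_Range[symmetric] by (intro card_image inj_onI) (auto dest: matchingD)

text \<open>\<open>X\<close> consists of the left vertices reached from vertices covered by \<open>M\<close> only, along paths
  alternating between \<open>M\<close> and \<open>N\<close>. The matching \<open>P\<close> follows \<open>M\<close> on \<open>X\<close> and \<open>N\<close> elsewhere.\<close>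

theorem mendelsohn_dulmage:
  assumes M: "matching M" and N: "matching N"
  obtains P where "matching P" "P \<subseteq> M \<union> N" "Domain M \<subseteq> Domain P" "Range N \<subseteq> Range P"
proof
  define X where "X = ((M O N\<inverse>)\<^sup>*) `` (Domain M - Domain N)"
  have X_step: "c \<in> X" if "a \<in> X" "(a, b) \<in> M" "(c, b) \<in> N" for a b c
    using that unfolding X_def by (blast intro: rtrancl_into_rtrancl)
  have X_cases: "c \<notin> Domain N \<or> (\<exists>a\<in>X. \<exists>b. (a, b) \<in> M \<and> (c, b) \<in> N)" if c: "c \<in> X" for c
  proof -
    obtain z where z: "z \<in> Domain M - Domain N" "(z, c) \<in> (M O N\<inverse>)\<^sup>*"
      using c unfolding X_def by blast
    from z(2) show ?thesis
    proof (cases rule: rtranclE)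
      case base
      with z(1) show ?thesis by blast
    next
      case (step a)
      with z(1) have "a \<in> X" unfolding X_def by blast
      with step(2) show ?thesis by blast
    qed
  qed
  define P where "P = {(a, b) \<in> M. a \<in> X} \<union> {(c, b) \<in> N. c \<notin> X}"
  show "matching P"
  proof (rule matchingI)
    show "b = b'" if "(a, b) \<in> P" "(a, b') \<in> P" for a b b'
      using that matchingD(1)[OF M] matchingD(1)[OF N] unfolding P_def by blast
    \<comment> \<open>The critical clash is between an arc of \<open>M\<close> starting in
      \<open>X\<close> and an arc of \<open>N\<close> starting outside \<open>X\<close>;
      \<open>X_step\<close> would put the latter start into \<open>X\<close>.\<close>
    show "a = a'" if "(a, b) \<in> P" "(a', b) \<in> P" for a a' b
      using that matchingD(2)[OF M] matchingD(2)[OF N] X_step unfolding P_def by blast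
  qed
  show "P \<subseteq> M \<union> N" by (auto simp: P_def)
  show "Domain M \<subseteq> Domain P"
  proof
    fix a assume "a \<in> Domain M"
    moreover have "a \<in> X" if "a \<in> Domain M" "a \<notin> Domain N" using that unfolding X_def by blast
    ultimately show "a \<in> Domain P" unfolding P_def by blast
  qed
  show "Range N \<subseteq> Range P"
  proof
    fix b assume "b \<in> Range N"
    then obtain c where c: "(c, b) \<in> N" by blast
    \<comment> \<open>If \<open>c\<close> lies in \<open>X\<close>, it was reached backwards along
      its only arc of \<open>N\<close>, so \<open>b\<close> is also the end of an arc of
      \<open>M\<close> that starts in \<open>X\<close>.\<close>
    show "b \<in> Range P"
    proof (cases "c \<in> X")
      case True
      with X_cases c obtain a b' where "a \<in> X" "(a, b') \<in> M" "(c, b') \<in> N" by blast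
      moreover from this c have "b' = b" using matchingD(1)[OF N] by blast
      ultimately show ?thesis unfolding P_def by blast
    qed (use c in \<open>auto simp: P_def\<close>)
  qed
qed

section \<open>Matchings from conditions of Hall type\<close>

text \<open>Add \<open>d\<close> dummy right vertices adjacent to everything, apply Hall's theorem,
  and discard the pairs that use a dummy.\<close>

lemma matching_with_deficiency:
  assumes "finite V" and "\<And>x. x \<in> V \<Longrightarrow> finite (E `` {x})"
    and hall: "\<And>J. J \<subseteq> V \<Longrightarrow> card J \<le> card (E `` J) + d"
  obtains M where "matching M" "M \<subseteq> E" "Domain M \<subseteq> V" "card V \<le> card M + d"
proof -
  define A :: "'a \<Rightarrow> ('b + nat) set" where "A x = E `` {x} <+> {..<d}" for x
  \<comment> \<open>The empty set is treated apart because its union contains no dummies.\<close>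
  have "card J \<le> card (\<Union> (A ` J))" if J: "J \<subseteq> V" for J
  proof (cases "J = {}")
    case False
    then have "\<Union> (A ` J) = E `` J <+> {..<d}" by (auto simp: A_def)
    moreover have "finite (E `` J)"
      using J assms(1,2) by (subst Image_eq_UN) (blast intro: finite_subset)
    ultimately show ?thesis using hall[OF J] by (simp add: card_Plus)
  qed simp
  then have "\<exists>f. inj_on f V \<and> (\<forall>x\<in>V. f x \<in> A x)"
    using assms(1,2) by (intro hall_marriage) (auto simp: A_def)
  then obtain f where f: "inj_on f V" "\<And>x. x \<in> V \<Longrightarrow> f x \<in> A x" by blast
  define M where "M = {(x, y). x \<in> V \<and> f x = Inl y}"
  show thesis
  proof
    show M: "matching M"
      by (rule matchingI) (use f(1) in \<open>auto simp: M_def inj_on_def\<close>)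
    show "M \<subseteq> E" using f(2) by (fastforce simp: M_def A_def)
    show D: "Domain M \<subseteq> V" by (auto simp: M_def)
    have "f ` (V - Domain M) \<subseteq> Inr ` {..<d}"
      using f(2) by (fastforce simp: M_def A_def)
    then have "card (f ` (V - Domain M)) \<le> card (Inr ` {..<d} :: ('b + nat) set)"
      by (intro card_mono) auto
    also have "\<dots> = d" by (simp add: card_image)
    also have "card (f ` (V - Domain M)) = card (V - Domain M)"
      using f(1) by (intro card_image) (auto intro: inj_on_subset)
    finally show "card V \<le> card M + d"
      using D matching_card_Domain[OF M] \<open>finite V\<close>
      by (simp add: card_Diff_subset finite_subset)
  qed
qed

text \<open>Every right vertex is doubled by a boolean tag; a system of distinct representatives
  then splits by tag into two matchings.\<close>

lemma two_matchings_cover: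
  assumes "finite V" and "\<And>x. x \<in> V \<Longrightarrow> finite (E `` {x})"
    and hall: "\<And>J. J \<subseteq> V \<Longrightarrow> card J \<le> 2 * card (E `` J)"
  obtains M N where "matching M" "matching N" "M \<subseteq> E" "N \<subseteq> E" "Domain M \<union> Domain N = V"
proof -
  define A where "A x = E `` {x} \<times> (UNIV :: bool set)" for x
  have "card J \<le> card (\<Union> (A ` J))" if J: "J \<subseteq> V" for J
  proof -
    have "\<Union> (A ` J) = E `` J \<times> UNIV" by (auto simp: A_def)
    then show ?thesis using hall[OF J] by (simp add: card_cartesian_product)
  qed
  then have "\<exists>f. inj_on f V \<and> (\<forall>x\<in>V. f x \<in> A x)"
    using assms(1,2) by (intro hall_marriage) (auto simp: A_def)
  then obtain f where f: "inj_on f V" "\<And>x. x \<in> V \<Longrightarrow> f x \<in> A x" by blast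
  define M where "M c = {(x, y). x \<in> V \<and> f x = (y, c)}" for c
  have "matching (M c)" for c
    by (rule matchingI) (use f(1) in \<open>auto simp: M_def inj_on_def\<close>)
  moreover have "M c \<subseteq> E" for c using f(2) by (fastforce simp: M_def A_def)
  moreover have "Domain (M True) \<union> Domain (M False) = V"
  proof
    show "V \<subseteq> Domain (M True) \<union> Domain (M False)"
    proof
      fix x assume "x \<in> V"
      moreover obtain y c where "f x = (y, c)" by (cases "f x")
      ultimately show "x \<in> Domain (M True) \<union> Domain (M False)" by (cases c) (auto simp: M_def)
    qed
  qed (auto simp: M_def)
  ultimately show thesis using that by blast
qed

lemma covering_matching_exists:
  assumes "finite V" "E \<subseteq> V \<times> V" "sym E"
    and "\<And>J. J \<subseteq> V \<Longrightarrow> card J \<le> 2 * card (E `` J)"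
    and "\<And>J. J \<subseteq> V \<Longrightarrow> card J \<le> card (E `` J) + d"
  obtains P where "matching P" "P \<subseteq> E" "Domain P \<union> Range P = V" "card V \<le> card P + d"
proof -
  have finE: "finite (E `` {x})" for x
    using assms(1,2) by (auto intro: finite_subset[of _ V])
  have finP: "finite P" if "P \<subseteq> E" for P
    using that assms(1,2) by (meson finite_SigmaI finite_subset)
  obtain M N where MN: "matching M" "matching N" "M \<subseteq> E" "N \<subseteq> E" "Domain M \<union> Domain N = V"
    using two_matchings_cover[OF assms(1) finE assms(4)] by metis
  obtain L where L: "matching L" "L \<subseteq> E" "card V \<le> card L + d"
    using matching_with_deficiency[OF assms(1) finE assms(5)] by metis
  \<comment> \<open>\<open>Q\<close> keeps the left ends of \<open>M\<close> and the right ends of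
    \<open>L\<close>, hence has at least as many arcs as \<open>L\<close>.\<close>
  obtain Q where Q: "matching Q" "Q \<subseteq> M \<union> L" "Domain M \<subseteq> Domain Q" "Range L \<subseteq> Range Q"
    using mendelsohn_dulmage[OF MN(1) L(1)] by blast
  have QE: "Q \<subseteq> E" using Q MN L by blast
  \<comment> \<open>Reversing \<open>N\<close> moves its left ends to the right side, so they can be
    added without losing left ends of \<open>Q\<close>.\<close>
  obtain P where P: "matching P" "P \<subseteq> Q \<union> N\<inverse>" "Domain Q \<subseteq> Domain P" "Range (N\<inverse>) \<subseteq> Range P"
    using mendelsohn_dulmage[OF Q(1), of "N\<inverse>"] MN(2) matching_converse by blast
  have "N\<inverse> \<subseteq> E" using MN(4) \<open>sym E\<close> by (auto dest: symD)
  then have PE: "P \<subseteq> E" using P(2) QE by blast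
  have "card L \<le> card Q"
    using Q L QE by (metis card_mono finP finite_Range matching_card_Range)
  moreover have "card Q \<le> card P"
    using P Q PE by (metis card_mono finP finite_Domain matching_card_Domain)
  moreover have "Domain P \<union> Range P = V"
  proof
    have "Domain M \<subseteq> Domain P" using P(3) Q(3) by (rule order_trans[rotated])
    moreover have "Domain N \<subseteq> Range P" using P(4) by simp
    ultimately show "V \<subseteq> Domain P \<union> Range P" using MN(5) by blast
  qed (use PE assms(2) in blast)
  ultimately show thesis using that P PE L by fastforce
qed

lemma pair_graph_iff:
  "pair_graph C \<longleftrightarrow>
     finite (pverts C) \<and> parcs C \<subseteq> pverts C \<times> pverts C \<and> sym (parcs C) \<and> irrefl (parcs C)"
proof
  assume "pair_graph C"
  then interpret pair_graph C .
  show "finite (pverts C) \<and> parcs C \<subseteq> pverts C \<times> pverts C \<and> sym (parcs C) \<and> irrefl (parcs C)"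
    using pair_finite_verts arcs_symmetric no_loops' wellformed' by (auto simp: sym_def irrefl_def)
next
  assume C: "finite (pverts C) \<and> parcs C \<subseteq> pverts C \<times> pverts C \<and> sym (parcs C) \<and> irrefl (parcs C)"
  then have "finite (parcs C)" by (meson finite_SigmaI finite_subset)
  with C show "pair_graph C"
    by unfold_locales (auto simp: symmetric_def irrefl_def)
qed

section \<open>Independent sets and neighbourhoods\<close>

lemma independent_set_neighbours:
  assumes "pair_graph G" "X \<subseteq> pverts G"
  shows "independent_set G (X - parcs G `` X)"
  using assms by (auto simp: independent_set_def)

text \<open>An independent set is disjoint from its neighbourhood, so it survives the deletion of
  the latter, with no possible neighbour left.\<close>

lemma card_le_num_isolated:
  assumes "pair_graph G" "independent_set G X"
  shows "card X \<le> num_isolated (delete_verts G (parcs G `` X))"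
proof -
  interpret pair_graph G by fact
  have X: "X \<subseteq> pverts G" "X \<inter> parcs G `` X = {}"
    using assms(2) by (auto simp: independent_set_def)
  show ?thesis
    unfolding num_isolated_def
  proof (rule card_mono)
    show "X \<subseteq> {v \<in> verts (delete_verts G (parcs G `` X)).
        \<forall>u\<in>verts (delete_verts G (parcs G `` X)). \<not> v \<rightarrow>\<^bsub>delete_verts G (parcs G `` X)\<^esub> u}"
      using X by (auto simp: delete_verts_def arcs_ends_conv)
  qed (use pair_finite_verts in \<open>auto simp: delete_verts_def\<close>)
qed

text \<open>A vertex of \<open>X\<close> that has a neighbour in \<open>X\<close> counts on both sides, and the remaining
  vertices of \<open>X\<close> form an independent set without neighbours in \<open>X\<close>.\<close>

lemma card_le_neighbours:
  assumes G: "pair_graph G" and "c \<ge> 1"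
    and indep: "\<And>X. independent_set G X \<Longrightarrow> card X \<le> c * card (parcs G `` X) + d"
    and J: "J \<subseteq> pverts G"
  shows "card J \<le> c * card (parcs G `` J) + d"
proof -
  interpret pair_graph G by fact
  let ?N = "\<lambda>X. parcs G `` X"
  have fin: "finite (?N X)" "finite J" for X
    using pair_finite_arcs J pair_finite_verts by (auto intro: finite_Image finite_subset)
  \<comment> \<open>If a vertex \<open>x\<close> of \<open>J\<close> had a neighbour in
    \<open>J\<close>, symmetry would put \<open>x\<close> into \<open>?N J\<close>.\<close>
  have disj: "?N (J - ?N J) \<subseteq> ?N J - J"
    using arcs_symmetric by blast
  have "card J = card (J \<inter> ?N J) + card (J - ?N J)"
    using fin by (metis card_Int_Diff)
  also have "card (J - ?N J) \<le> c * card (?N (J - ?N J)) + d"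
    using independent_set_neighbours[OF G J] by (rule indep)
  also have "card (?N (J - ?N J)) \<le> card (?N J - J)"
    using disj fin by (intro card_mono) auto
  also have "card (J \<inter> ?N J) \<le> c * card (J \<inter> ?N J)" using \<open>c \<ge> 1\<close> by simp
  finally have "card J \<le> c * (card (?N J \<inter> J) + card (?N J - J)) + d"
    by (simp add: algebra_simps Int_commute)
  also have "card (?N J \<inter> J) + card (?N J - J) = card (?N J)"
    using fin by (metis card_Int_Diff)
  finally show ?thesis .
qed

section \<open>Disjoint unions of strongly connected graphs\<close>

lemma strongly_connected_root:
  assumes "pair_graph C" "r \<in> pverts C" "\<And>v. v \<in> pverts C \<Longrightarrow> r \<rightarrow>\<^sup>*\<^bsub>with_proj C\<^esub> v"
  shows "strongly_connected (with_proj C)"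
proof -
  interpret pair_graph C by fact
  show ?thesis
  proof (rule strongly_connectedI)
    fix u v assume "u \<in> verts (with_proj C)" "v \<in> verts (with_proj C)"
    then have "r \<rightarrow>\<^sup>*\<^bsub>with_proj C\<^esub> u" "r \<rightarrow>\<^sup>*\<^bsub>with_proj C\<^esub> v"
      using assms(3) by simp_all
    then show "u \<rightarrow>\<^sup>*\<^bsub>with_proj C\<^esub> v"
      using symmetric_reachable[OF pair_sym_arcs] reachable_trans by metis
  qed (use assms(2) in auto)
qed

definition disjoint_graph_union :: "'a pair_pre_digraph set \<Rightarrow> 'a pair_pre_digraph" where
  "disjoint_graph_union \<C> = \<lparr> pverts = \<Union> (pverts ` \<C>), parcs = \<Union> (parcs ` \<C>) \<rparr>"

lemma disjoint_graph_union_simps [simp]: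
  "pverts (disjoint_graph_union \<C>) = \<Union> (pverts ` \<C>)"
  "parcs (disjoint_graph_union \<C>) = \<Union> (parcs ` \<C>)"
  by (simp_all add: disjoint_graph_union_def)

lemma pair_graph_disjoint_graph_union:
  assumes "finite \<C>" "\<And>C. C \<in> \<C> \<Longrightarrow> pair_graph C"
  shows "pair_graph (disjoint_graph_union \<C>)"
  unfolding pair_graph_iff
proof (intro conjI)
  have C: "finite (pverts C)" "parcs C \<subseteq> pverts C \<times> pverts C" "sym (parcs C)" "irrefl (parcs C)"
    if "C \<in> \<C>" for C
    using assms(2)[OF that] by (auto simp: pair_graph_iff)
  show "finite (pverts (disjoint_graph_union \<C>))" using C(1) assms(1) by auto
  show "parcs (disjoint_graph_union \<C>)
      \<subseteq> pverts (disjoint_graph_union \<C>) \<times> pverts (disjoint_graph_union \<C>)"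
    using C(2) by fastforce
  show "sym (parcs (disjoint_graph_union \<C>))" using C(3) by (auto intro!: sym_UNION)
  show "irrefl (parcs (disjoint_graph_union \<C>))" using C(4) by (auto simp: irrefl_def)
qed

text \<open>By disjointness no arc leaves a member, so reachability from a vertex stays in its
  member; strong connectivity gives the whole member.\<close>

lemma sccs_disjoint_graph_union:
  assumes "finite \<C>" and graph: "\<And>C. C \<in> \<C> \<Longrightarrow> pair_graph C"
    and conn: "\<And>C. C \<in> \<C> \<Longrightarrow> strongly_connected (with_proj C)"
    and disj: "\<And>C D. C \<in> \<C> \<Longrightarrow> D \<in> \<C> \<Longrightarrow> C \<noteq> D \<Longrightarrow> pverts C \<inter> pverts D = {}"
  shows "pre_digraph.sccs (with_proj (disjoint_graph_union \<C>)) = with_proj ` \<C>"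
proof -
  let ?F = "disjoint_graph_union \<C>"
  interpret pair_graph ?F by (rule pair_graph_disjoint_graph_union) (fact assms)+
  have wf: "u \<in> pverts C \<and> v \<in> pverts C" if "C \<in> \<C>" "(u, v) \<in> parcs C" for C u v
    using graph[OF that(1)] that(2) by (auto simp: pair_graph_iff)
  have arc: "(u, v) \<in> parcs C \<and> v \<in> pverts C" if "C \<in> \<C>" "u \<in> pverts C" "(u, v) \<in> parcs ?F" for C u v
  proof -
    obtain D where D: "D \<in> \<C>" "(u, v) \<in> parcs D" using \<open>(u, v) \<in> parcs ?F\<close> by auto
    then have "D = C" using wf[OF D] disj[OF D(1) \<open>C \<in> \<C>\<close>] \<open>u \<in> pverts C\<close> by blast
    with D wf show ?thesis by blast
  qed
  have scc: "scc_of u = pverts C" if C: "C \<in> \<C>" "u \<in> pverts C" for C u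
  proof
    show "scc_of u \<subseteq> pverts C"
    proof
      fix v assume "v \<in> scc_of u"
      then have "u \<rightarrow>\<^sup>*\<^bsub>with_proj ?F\<^esub> v" by (simp add: scc_of_def)
      then show "v \<in> pverts C"
        by (induction rule: reachable_induct) (use C arc in auto)
    qed
    have sub: "subgraph (with_proj C) (with_proj ?F)"
    proof (rule subgraphI)
      show "wf_digraph (with_proj C)" using C wf by (auto simp: wf_digraph_def)
      show "wf_digraph (with_proj ?F)" by unfold_locales
    qed (use C in auto)
    show "pverts C \<subseteq> scc_of u"
    proof
      fix v assume "v \<in> pverts C"
      then have "u \<rightarrow>\<^sup>*\<^bsub>with_proj C\<^esub> v" "v \<rightarrow>\<^sup>*\<^bsub>with_proj C\<^esub> u"
        using C conn by (auto simp: strongly_connected_def)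
      then show "v \<in> scc_of u" using sub reachable_mono by (auto simp: scc_of_def)
    qed
  qed
  have nonempty: "pverts C \<noteq> {}" if "C \<in> \<C>" for C
    using conn[OF that] by (auto simp: strongly_connected_def)
  have "sccs_verts = pverts ` \<C>"
  proof (rule set_eqI)
    fix S
    show "S \<in> sccs_verts \<longleftrightarrow> S \<in> pverts ` \<C>"
      unfolding sccs_verts_conv_scc_of using scc nonempty by (fastforce simp: image_iff)
  qed
  \<comment> \<open>The library's components are induced subgraphs, so equality of vertex sets does
    not suffice: the arcs inside \<open>pverts C\<close> must be exactly those of
    \<open>C\<close>.\<close>
  moreover have "with_proj ?F \<restriction> pverts C = with_proj C" if "C \<in> \<C>" for C
  proof -
    have "{e \<in> parcs ?F. fst e \<in> pverts C \<and> snd e \<in> pverts C} = parcs C"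
    proof
      show "{e \<in> parcs ?F. fst e \<in> pverts C \<and> snd e \<in> pverts C} \<subseteq> parcs C"
        using arc[OF that] by (metis (no_types, lifting) mem_Collect_eq prod.collapse subsetI)
      show "parcs C \<subseteq> {e \<in> parcs ?F. fst e \<in> pverts C \<and> snd e \<in> pverts C}"
        using wf[OF that] that by (auto simp del: UN_iff intro: UN_I)
    qed
    then show ?thesis unfolding induce_subgraph_def by (simp add: with_proj_def)
  qed
  ultimately show ?thesis
    unfolding sccs_conv_sccs_verts by (simp add: image_image cong: image_cong)
qed

section \<open>Decomposing a matching into components of a factor\<close>

definition factor_component :: "('a \<times> 'a) set \<Rightarrow> 'a pair_pre_digraph \<Rightarrow> bool" where
  "factor_component E C \<longleftrightarrow> pair_graph C \<and> strongly_connected (with_proj C) \<and> parcs C \<subseteq> E \<and>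
     (K\<^bsub>1,1\<^esub> (with_proj C) \<or> K\<^bsub>1,2\<^esub> (with_proj C) \<or>
       (\<exists>k\<ge>3. digraph_iso (with_proj C) (with_proj (circuit_graph k))))"

text \<open>The arc set \<open>E\<close> stays fixed while \<open>V\<close> varies, so that
  \<open>matching_factorable\<close> can remove vertices by induction.\<close>

definition factorable :: "('a \<times> 'a) set \<Rightarrow> 'a set \<Rightarrow> nat \<Rightarrow> bool" where
  "factorable E V t \<longleftrightarrow> (\<exists>\<C>. finite \<C> \<and> (\<forall>C\<in>\<C>. factor_component E C) \<and>
     (\<forall>C\<in>\<C>. \<forall>D\<in>\<C>. C \<noteq> D \<longrightarrow> pverts C \<inter> pverts D = {}) \<and> \<Union> (pverts ` \<C>) = V \<and>
     card {C \<in> \<C>. K\<^bsub>1,2\<^esub> (with_proj C)} \<le> t)"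

lemma factorable_empty: "factorable E {} t"
  unfolding factorable_def by (intro exI[of _ "{}"]) simp

lemma factorable_insert:
  assumes "factorable E V t" "factor_component E C" "pverts C \<inter> V = {}"
    and "t \<le> s" "K\<^bsub>1,2\<^esub> (with_proj C) \<Longrightarrow> t < s"
  shows "factorable E (pverts C \<union> V) s"
proof -
  obtain \<C> where \<C>: "finite \<C>" "\<forall>C\<in>\<C>. factor_component E C"
      "\<forall>C\<in>\<C>. \<forall>D\<in>\<C>. C \<noteq> D \<longrightarrow> pverts C \<inter> pverts D = {}" "\<Union> (pverts ` \<C>) = V"
      "card {C \<in> \<C>. K\<^bsub>1,2\<^esub> (with_proj C)} \<le> t"
    using assms(1) unfolding factorable_def by blast
  let ?K = "\<lambda>\<D>. {D \<in> \<D>. K\<^bsub>1,2\<^esub> (with_proj D)}"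
  have "card (?K (insert C \<C>)) \<le> s"
  proof (cases "K\<^bsub>1,2\<^esub> (with_proj C)")
    case True
    then have "?K (insert C \<C>) = insert C (?K \<C>)" by blast
    then have "card (?K (insert C \<C>)) \<le> Suc (card (?K \<C>))"
      using \<C>(1) by (simp add: card_insert_if)
    with assms(5)[OF True] \<C>(5) show ?thesis by linarith
  next
    case False
    then have "?K (insert C \<C>) = ?K \<C>" by blast
    then have "card (?K (insert C \<C>)) = card (?K \<C>)" by (rule arg_cong)
    with assms(4) \<C>(5) show ?thesis by linarith
  qed
  then show ?thesis
    using \<C> assms(2,3) unfolding factorable_def by (intro exI[of _ "insert C \<C>"]) auto
qed

lemma factorable_imp_factor:
  assumes G: "pair_graph G" and "factorable (parcs G) (pverts G) t"
  obtains F where "star_circuit_factor G F" "num_K12_components F \<le> t"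
proof -
  obtain \<C> where \<C>: "finite \<C>" "\<forall>C\<in>\<C>. factor_component (parcs G) C"
      "\<forall>C\<in>\<C>. \<forall>D\<in>\<C>. C \<noteq> D \<longrightarrow> pverts C \<inter> pverts D = {}" "\<Union> (pverts ` \<C>) = pverts G"
      "card {C \<in> \<C>. K\<^bsub>1,2\<^esub> (with_proj C)} \<le> t"
    using assms(2) unfolding factorable_def by blast
  let ?F = "disjoint_graph_union \<C>"
  have F: "pair_graph ?F"
    using \<C>(1,2) by (intro pair_graph_disjoint_graph_union) (auto simp: factor_component_def)
  have sccs: "pre_digraph.sccs (with_proj ?F) = with_proj ` \<C>"
    using \<C>(1-3) by (intro sccs_disjoint_graph_union) (auto simp: factor_component_def)
  have "wf_digraph (with_proj H)" if "pair_graph H" for H :: "'a pair_pre_digraph"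
    using that by (auto simp: pair_graph_iff wf_digraph_def)
  then have "spanning (with_proj ?F) (with_proj G)"
    using F G \<C>(2,4) by (auto simp: spanning_def subgraph_def factor_component_def)
  then have "star_circuit_factor G ?F"
    unfolding star_circuit_factor_def sccs using F \<C>(2) by (auto simp: factor_component_def)
  moreover have "num_K12_components ?F \<le> t"
  proof -
    have "{C \<in> with_proj ` \<C>. K\<^bsub>1,2\<^esub> C} = with_proj ` {C \<in> \<C>. K\<^bsub>1,2\<^esub> (with_proj C)}" by blast
    then show ?thesis
      unfolding num_K12_components_def sccs
      using card_image_le[of "{C \<in> \<C>. K\<^bsub>1,2\<^esub> (with_proj C)}" with_proj] \<C>(1,5) by simp
  qed
  ultimately show thesis using that by blast
qed

section \<open>Edges, three-vertex paths and circuits as components\<close>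

lemma card_pverts_K12: "K\<^bsub>1,2\<^esub> (with_proj C) \<Longrightarrow> card (pverts C) = 3"
  unfolding complete_bipartite_digraph_pair_def
  by (auto simp: card_Un_disjoint)

lemma strongly_connected_star:
  assumes C: "pair_graph C" "r \<in> pverts C" and "\<And>v. v \<in> pverts C \<Longrightarrow> v = r \<or> (r, v) \<in> parcs C"
  shows "strongly_connected (with_proj C)"
proof (rule strongly_connected_root[OF C])
  interpret pair_graph C by fact
  show "r \<rightarrow>\<^sup>*\<^bsub>with_proj C\<^esub> v" if "v \<in> pverts C" for v
    using assms(3)[OF that] C(2) by auto
qed

lemma factor_component_edge:
  assumes "u \<noteq> v" "(u, v) \<in> E" "sym E"
  shows "factor_component E \<lparr> pverts = {u, v}, parcs = {(u, v), (v, u)} \<rparr>"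
  unfolding factor_component_def
proof (intro conjI disjI1)
  let ?C = "\<lparr> pverts = {u, v}, parcs = {(u, v), (v, u)} \<rparr>"
  show "pair_graph ?C" using assms by (auto simp: pair_graph_iff sym_def irrefl_def)
  then show "strongly_connected (with_proj ?C)" by (rule strongly_connected_star[of _ u]) auto
  show "parcs ?C \<subseteq> E" using assms by (auto dest: symD)
  show "K\<^bsub>1,1\<^esub> (with_proj ?C)"
    unfolding complete_bipartite_digraph_pair_def using assms(1)
    by (intro conjI exI[of _ "{u}"] exI[of _ "{v}"]) auto
qed

lemma factor_component_path:
  assumes "u \<noteq> v" "v \<noteq> w" "u \<noteq> w" "(u, v) \<in> E" "(v, w) \<in> E" "sym E"
  shows "factor_component E \<lparr> pverts = {u, v, w}, parcs = {(u, v), (v, u), (v, w), (w, v)} \<rparr>"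
  unfolding factor_component_def
proof (intro conjI disjI2[OF disjI1])
  let ?C = "\<lparr> pverts = {u, v, w}, parcs = {(u, v), (v, u), (v, w), (w, v)} \<rparr>"
  show "pair_graph ?C" using assms by (auto simp: pair_graph_iff sym_def irrefl_def)
  then show "strongly_connected (with_proj ?C)" by (rule strongly_connected_star[of _ v]) auto
  show "parcs ?C \<subseteq> E" using assms by (auto dest: symD)
  show "K\<^bsub>1,2\<^esub> (with_proj ?C)"
    unfolding complete_bipartite_digraph_pair_def using assms(1-3)
    by (intro conjI exI[of _ "{v}"] exI[of _ "{u, w}"]) auto
qed

text \<open>The isomorphism runs from the image back to \<open>H\<close>, the direction demanded of
  a factor's component; its vertex map is therefore the inverse of \<open>s\<close>.\<close>

lemma digraph_iso_image:
  assumes wf: "parcs H \<subseteq> pverts H \<times> pverts H" and inj: "inj_on s (pverts H)"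
  shows "digraph_iso (with_proj \<lparr> pverts = s ` pverts H, parcs = map_prod s s ` parcs H \<rparr>)
    (with_proj H)"
proof -
  let ?C = "\<lparr> pverts = s ` pverts H, parcs = map_prod s s ` parcs H \<rparr>"
  let ?r = "the_inv_into (pverts H) s"
  let ?f = "\<lparr> iso_verts = ?r, iso_arcs = map_prod ?r ?r, iso_head = snd, iso_tail = fst \<rparr>"
  have r: "?r (s x) = x" if "x \<in> pverts H" for x using inj that by (rule the_inv_into_f_f)
  have arc: "map_prod ?r ?r (map_prod s s e) = e" if "e \<in> parcs H" for e
    using that wf r by (cases e) auto
  have "pre_digraph.digraph_isomorphism (with_proj ?C) ?f"
    unfolding pre_digraph.digraph_isomorphism_def
  proof (intro conjI)
    show "wf_digraph (with_proj ?C)" using wf by (fastforce simp: wf_digraph_def)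
    show "inj_on (iso_verts ?f) (verts (with_proj ?C))"
      using r by (auto simp: inj_on_def)
    show "inj_on (iso_arcs ?f) (arcs (with_proj ?C))"
    proof (rule inj_on_inverseI)
      show "map_prod s s (iso_arcs ?f a) = a" if "a \<in> arcs (with_proj ?C)" for a
        using that arc by fastforce
    qed
  qed auto
  moreover have "with_proj H = app_iso ?f (with_proj ?C)"
    using r arc unfolding app_iso_def
    by (simp add: with_proj_def image_image cong: image_cong)
  ultimately show ?thesis unfolding digraph_iso_def by blast
qed

lemma factor_component_circuit:
  assumes k: "k \<ge> 3" and inj: "inj_on s {..<k}"
    and E: "\<And>i. i < k \<Longrightarrow> (s i, s (Suc i mod k)) \<in> E" and "sym E"
  obtains C where "factor_component E C" "pverts C = s ` {..<k}" "\<not> K\<^bsub>1,2\<^esub> (with_proj C)"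
proof
  let ?H = "circuit_graph k"
  let ?C = "\<lparr> pverts = s ` pverts ?H, parcs = map_prod s s ` parcs ?H \<rparr>"
  have H: "pverts ?H = {..<k}" "parcs ?H \<subseteq> {..<k} \<times> {..<k}"
    using k by (auto simp: circuit_graph_def)
  have neq: "Suc i mod k \<noteq> i" if "i < k" for i
    using that k by (cases "Suc i = k") auto
  have parcs: "parcs ?C = {(s i, s (Suc i mod k)) |i. i < k} \<union> {(s (Suc i mod k), s i) |i. i < k}"
    by (auto simp: circuit_graph_def image_Un image_Collect)
  have graph: "pair_graph ?C"
    unfolding pair_graph_iff
  proof (intro conjI)
    show "finite (pverts ?C)" using H by simp
    show "parcs ?C \<subseteq> pverts ?C \<times> pverts ?C" using H by auto
    show "sym (parcs ?C)" unfolding parcs by (rule symI) blast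
    have "s i \<noteq> s (Suc i mod k)" if "i < k" for i
      using neq[OF that] inj that k by (auto simp: inj_on_def)
    then show "irrefl (parcs ?C)" unfolding parcs irrefl_def by (auto dest: sym)
  qed
  interpret C: pair_graph ?C by fact
  show "factor_component E ?C"
    unfolding factor_component_def
  proof (intro conjI disjI2 exI)
    show "pair_graph ?C" by fact
    show "strongly_connected (with_proj ?C)"
    proof (rule strongly_connected_root[OF graph])
      show "s 0 \<in> pverts ?C" using H k by auto
      have "s 0 \<rightarrow>\<^sup>*\<^bsub>with_proj ?C\<^esub> s i" if "i < k" for i
        using that
      proof (induction i)
        case 0
        then show ?case using H by (intro C.reachable_refl) auto
      next
        case (Suc i)
        then have "(s i, s (Suc i mod k)) \<in> parcs ?C" unfolding parcs using Suc_lessD by blast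
        then have arc: "(s i, s (Suc i)) \<in> parcs ?C" using Suc.prems by (simp only: mod_less)
        have "s 0 \<rightarrow>\<^sup>*\<^bsub>with_proj ?C\<^esub> s i" by (rule Suc.IH[OF Suc_lessD[OF Suc.prems]])
        then show ?case using arc by (rule C.reachable_adj_trans)
      qed
      then show "s 0 \<rightarrow>\<^sup>*\<^bsub>with_proj ?C\<^esub> v" if "v \<in> pverts ?C" for v
        using that H by auto
    qed
    show "parcs ?C \<subseteq> E" unfolding parcs using E \<open>sym E\<close> by (auto dest: symD)
    show "digraph_iso (with_proj ?C) (with_proj ?H)"
      using H inj by (intro digraph_iso_image) auto
  qed (fact k)
  show "pverts ?C = s ` {..<k}" using H by simp
  show "\<not> K\<^bsub>1,2\<^esub> (with_proj ?C)"
  proof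
    assume K12: "K\<^bsub>1,2\<^esub> (with_proj ?C)"
    then have "k = 3" using card_pverts_K12[of ?C] H inj by (simp add: card_image)
    \<comment> \<open>Counting vertices leaves only the triangle. There any two vertices are
      adjacent, unlike the two vertices in the larger part of a star.\<close>
    have adj: "(x, y) \<in> parcs ?C" if xy: "x \<in> pverts ?C" "y \<in> pverts ?C" "x \<noteq> y" for x y
    proof -
      obtain i j where "x = s i" "y = s j" "i < k" "j < k" "i \<noteq> j"
        using xy H by auto
      moreover from this \<open>k = 3\<close> have "i \<in> {0, 1, 2}" "j \<in> {0, 1, 2}" by auto
      with \<open>i \<noteq> j\<close> \<open>k = 3\<close> have "j = Suc i mod k \<or> i = Suc j mod k" by auto
      ultimately show ?thesis unfolding parcs by blast
    qed
    obtain U V where UV: "pverts ?C = U \<union> V" "U \<inter> V = {}" "card V = 2" "parcs ?C = U \<times> V \<union> V \<times> U"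
      using K12 unfolding complete_bipartite_digraph_pair_def by blast
    from \<open>card V = 2\<close> obtain x y where "V = {x, y}" "x \<noteq> y" by (auto simp: card_2_iff)
    with UV adj[of x y] show False by auto
  qed
qed

section \<open>Splitting a matching into components\<close>

text \<open>Iterated successors stay in the finite set \<open>Domain P\<close> and must repeat. As
  predecessors are unique, a repetition can be shifted back to the start \<open>s 0\<close>, and the
  first return closes an injective walk.\<close>

lemma matching_closed_walk:
  assumes P: "matching P" and V: "finite (Domain P)" "Range P \<subseteq> Domain P" "Domain P \<noteq> {}"
  obtains s :: "nat \<Rightarrow> 'a" and k where "k > 0" "inj_on s {..<k}" "\<And>i. i < k \<Longrightarrow> (s i, s (Suc i mod k)) \<in> P"
proof -
  obtain v where v: "v \<in> Domain P" using V by blast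
  define s where "s i = ((\<lambda>x. SOME y. (x, y) \<in> P) ^^ i) v" for i
  have step: "(x, SOME y. (x, y) \<in> P) \<in> P" if "x \<in> Domain P" for x
    using that by (auto intro: someI)
  have dom: "s i \<in> Domain P" for i
    by (induction i) (use v step V(2) in \<open>auto simp: s_def\<close>)
  have arc: "(s i, s (Suc i)) \<in> P" for i
    using step[OF dom[of i]] by (simp add: s_def)
  have cancel: "s (j - i) = s 0" if "s i = s j" "i \<le> j" for i j
    using that
  proof (induction i arbitrary: j)
    case (Suc i)
    then obtain j' where "j = Suc j'" by (cases j) auto
    with Suc arc[of i] arc[of j'] show ?case by (auto dest: matchingD(2)[OF P])
  qed simp
  have "\<not> inj s"
    using dom V(1) by (meson finite_imageD finite_subset image_subsetI infinite_UNIV_nat)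
  then obtain i j where "s i = s j" "i < j"
    by (metis injI linorder_neqE_nat)
  then have ex: "\<exists>k. k > 0 \<and> s k = s 0"
    using cancel[of i j] by (intro exI[of _ "j - i"]) auto
  define k where "k = (LEAST k. k > 0 \<and> s k = s 0)"
  have k: "k > 0" "s k = s 0"
    using LeastI_ex[OF ex] unfolding k_def by auto
  have least: "s l \<noteq> s 0" if "0 < l" "l < k" for l
    using not_less_Least[of l "\<lambda>k. k > 0 \<and> s k = s 0"] that unfolding k_def by auto
  have "inj_on s {..<k}"
  proof (rule linorder_inj_onI)
    fix i j assume "i < j" "i \<in> {..<k}" "j \<in> {..<k}"
    then show "s i \<noteq> s j" using cancel[of i j] least[of "j - i"] by auto
  qed auto
  moreover have "(s i, s (Suc i mod k)) \<in> P" if "i < k" for i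
    using arc[of i] that k by (cases "Suc i = k") auto
  ultimately show thesis using that k by blast
qed

text \<open>If some vertex is not in the range of \<open>P\<close>, a maximal \<open>P\<close>-path starts there, and edges are split
  off from its beginning; a path with three vertices remains if the number of its vertices is odd.
  If there is no such vertex, \<open>P\<close> is a permutation.\<close>

lemma matching_factorable:
  assumes "finite V" "sym E" "irrefl E" "matching P" "P \<subseteq> E" "Domain P \<union> Range P = V"
    and "card V \<le> card P + t"
  shows "factorable E V t"
  using assms(1,4-)
proof (induction V arbitrary: P t rule: finite_psubset_induct)
  case (psubset V)
  note P = \<open>matching P\<close> and PE = \<open>P \<subseteq> E\<close> and DR = \<open>Domain P \<union> Range P = V\<close>
    and t = \<open>card V \<le> card P + t\<close>
  \<comment> \<open>The induction step: \<open>C\<close> covers \<open>W\<close>, the matching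
    \<open>Q\<close> remains for \<open>V - W\<close>, and \<open>s\<close> bounds the stars with
    two edges allowed there.\<close>
  have split_off: "factorable E V t"
    if "factor_component E C" "pverts C = W" "W \<noteq> {}" "W \<subseteq> V" "Q \<subseteq> P"
      "Domain Q \<union> Range Q = V - W" "card V \<le> card Q + card W + s" "s \<le> t"
      "K\<^bsub>1,2\<^esub> (with_proj C) \<Longrightarrow> s < t"
    for C W Q s
  proof -
    have "card (V - W) \<le> card Q + s"
      using that \<open>finite V\<close> by (simp add: card_Diff_subset finite_subset)
    then have "factorable E (V - W) s"
      using that P PE by (intro psubset.IH[of _ Q]) (auto intro: matching_subset)
    then have "factorable E (pverts C \<union> (V - W)) t"
      using that by (intro factorable_insert) auto
    then show ?thesis using that by (simp add: Un_absorb1)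
  qed
  have finP: "finite P"
    using DR \<open>finite V\<close> by (intro finite_subset[of P "V \<times> V"]) auto
  have edge: "factor_component E \<lparr> pverts = {u, v}, parcs = {(u, v), (v, u)} \<rparr>"
      "\<not> K\<^bsub>1,2\<^esub> (with_proj \<lparr> pverts = {u, v}, parcs = {(u, v), (v, u)} \<rparr>)"
      "u \<noteq> v" if "(u, v) \<in> P" for u v
  proof -
    show "u \<noteq> v" using that PE \<open>irrefl E\<close> by (auto simp: irrefl_def)
    then show "factor_component E \<lparr> pverts = {u, v}, parcs = {(u, v), (v, u)} \<rparr>"
      using that PE \<open>sym E\<close> by (intro factor_component_edge) auto
    show "\<not> K\<^bsub>1,2\<^esub> (with_proj \<lparr> pverts = {u, v}, parcs = {(u, v), (v, u)} \<rparr>)"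
      using card_pverts_K12[of "\<lparr> pverts = {u, v}, parcs = {(u, v), (v, u)} \<rparr>"] \<open>u \<noteq> v\<close> by auto
  qed
  consider "V = {}" | "V \<noteq> {}" "Domain P = V" | u where "u \<in> V" "u \<notin> Range P"
  proof (cases "V \<subseteq> Range P")
    case True
    then have "Range P = V" using DR by blast
    then have "card (Domain P) = card V"
      using matching_card_Domain[OF P] matching_card_Range[OF P] by simp
    then have "Domain P = V" using DR \<open>finite V\<close> by (intro card_subset_eq) auto
    then show thesis using that(1,2) by blast
  qed (use that(3) in blast)
  then show ?case
  proof cases
    case 1
    then show ?thesis by (simp add: factorable_empty)
  next
    case 2
    obtain s :: "nat \<Rightarrow> 'a" and k where k: "k > 0" "inj_on s {..<k}"
      and arc: "\<And>i. i < k \<Longrightarrow> (s i, s (Suc i mod k)) \<in> P"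
      using matching_closed_walk[OF P] 2 DR \<open>finite V\<close> by (metis Un_upper2)
    let ?W = "s ` {..<k}"
    define Q where "Q = {(x, y) \<in> P. x \<notin> ?W}"
    have W: "?W \<noteq> {}" "?W \<subseteq> V" using k(1) arc 2 by auto
    \<comment> \<open>The circuit is closed under predecessors, so no remaining arc ends on
      it.\<close>
    have pred: "x \<in> ?W" if xy: "(x, y) \<in> P" "y \<in> ?W" for x y
    proof -
      obtain j where j: "y = s j" "j < k" using xy by auto
      obtain i where "i < k" "Suc i mod k = j"
      proof (cases j)
        case 0
        then show thesis using k(1) that[of "k - 1"] by simp
      next
        case (Suc i)
        then show thesis using j(2) that[of i] by simp
      qed
      then show ?thesis using arc[of i] j xy(1) matchingD(2)[OF P] by blast
    qed
    have QP: "Q \<subseteq> P" by (auto simp: Q_def)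
    have Dom: "Domain Q = V - ?W" using 2 by (auto simp: Q_def)
    moreover have "Range Q \<subseteq> V - ?W" using pred DR by (auto simp: Q_def)
    ultimately have DQ: "Domain Q \<union> Range Q = V - ?W" by blast
    have "card Q = card (V - ?W)"
      using matching_card_Domain[OF matching_subset[OF P QP]] Dom by simp
    then have card: "card V \<le> card Q + card ?W + t"
      using W \<open>finite V\<close> by (simp add: card_Diff_subset finite_subset card_mono)
    have "k \<noteq> 1" using arc[of 0] edge(3) by fastforce
    \<comment> \<open>A closed walk of length two traverses one edge in both directions and yields a
      single edge, not a circuit.\<close>
    consider "k = 2" | "k \<ge> 3" using k(1) \<open>k \<noteq> 1\<close> by linarith
    then show ?thesis
    proof cases
      case 1
      then have "?W = {s 0, s 1}" by (auto simp: lessThan_Suc numeral_2_eq_2)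
      moreover have "(s 0, s 1) \<in> P" using arc[of 0] 1 by simp
      ultimately show ?thesis
        using split_off[OF edge(1)[of "s 0" "s 1"] _ W, of Q t] edge(2) DQ card QP
        by simp
    next
      case 2
      obtain C where "factor_component E C" "pverts C = ?W" "\<not> K\<^bsub>1,2\<^esub> (with_proj C)"
        using factor_component_circuit[OF 2 k(2), of E] arc PE \<open>sym E\<close> by blast
      then show ?thesis
        using split_off[of C ?W Q t] W DQ card QP by simp
    qed
  next
    case (3 u)
    \<comment> \<open>Together with \<open>t\<close> this makes the allowance \<open>t\<close>
      positive, so that \<open>t - 1\<close> below is a genuine decrease.\<close>
    have card_lt: "card P < card V"
      using 3 DR \<open>finite V\<close> matching_card_Range[OF P] by (metis Un_upper2 psubsetI psubset_card_mono)
    obtain v where uv: "(u, v) \<in> P" using 3 DR by blast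
    show ?thesis
    proof (cases "v \<in> Domain P")
      case False
      \<comment> \<open>The path is just this arc, and it is split off without using the
        allowance.\<close>
      let ?Q = "P - {(u, v)}"
      have "Domain ?Q \<union> Range ?Q = V - {u, v}"
        using 3(2) False DR uv matchingD[OF P] by blast
      moreover have "card V \<le> card ?Q + card {u, v} + t"
        using t uv finP edge(3)[OF uv] by (simp add: card_Diff_singleton)
      ultimately show ?thesis
        using split_off[OF edge(1)[OF uv], of "{u, v}" ?Q t] edge(2)[OF uv] uv DR by auto
    next
      case True
      then obtain w where vw: "(v, w) \<in> P" by blast
      let ?Q = "P - {(u, v), (v, w)}"
      have neq: "u \<noteq> v" "v \<noteq> w" "u \<noteq> w" using edge(3) uv vw 3(2) by blast+
      have "card {(u, v), (v, w)} = 2" using neq by simp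
      then have cardQ: "card P = card ?Q + 2"
        using uv vw finP card_mono[of P "{(u, v), (v, w)}"] by (simp add: card_Diff_subset)
      show ?thesis
      proof (cases "w \<in> Domain P")
        case True
        \<comment> \<open>The path continues beyond \<open>w\<close>, so \<open>w\<close> stays
          covered although both arcs go. Two vertices and two arcs are lost, leaving
          \<open>t\<close> unchanged.\<close>
        then have "Domain ?Q \<union> Range ?Q = V - {u, v}"
          using 3(2) neq DR uv vw matchingD[OF P] by blast
        moreover have "card V \<le> card ?Q + card {u, v} + t" using t cardQ neq by simp
        ultimately show ?thesis
          using split_off[OF edge(1)[OF uv], of "{u, v}" ?Q t] edge(2)[OF uv] uv DR by auto
      next
        case False
        \<comment> \<open>The path ends at \<open>w\<close>. Three vertices go with only two arcs,
          and the drop of the deficiency by one pays for this star.\<close>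
        let ?C = "\<lparr> pverts = {u, v, w}, parcs = {(u, v), (v, u), (v, w), (w, v)} \<rparr>"
        have "factor_component E ?C"
          using neq uv vw PE \<open>sym E\<close> by (intro factor_component_path) auto
        moreover have "Domain ?Q \<union> Range ?Q = V - {u, v, w}"
          using False 3(2) neq DR uv vw matchingD[OF P] by blast
        moreover have "card V \<le> card ?Q + card {u, v, w} + (t - 1)"
          using t cardQ neq card_lt by simp
        moreover have "t - 1 < t" using card_lt t by simp
        ultimately show ?thesis
          using split_off[of ?C "{u, v, w}" ?Q "t - 1"] uv vw DR by auto
      qed
    qed
  qed
qed

section \<open>The two bounds\<close>

text \<open>Both isolation bounds are used with \<open>S\<close> the neighbourhood of an independent
  set; \<open>card_le_neighbours\<close> extends them to all vertex sets. Restricting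
  \<open>S\<close> to the complement of \<open>X\<close> lets a user of the theorem exploit that
  both fit into the vertex set.\<close>

theorem min_K12_le:
  assumes G: "pair_graph G"
    and "\<And>S. S \<subseteq> pverts G \<Longrightarrow> num_isolated (delete_verts G S) \<le> 2 * card S"
    and "\<And>X S. independent_set G X \<Longrightarrow> S \<subseteq> pverts G - X \<Longrightarrow> 
      card X \<le> num_isolated (delete_verts G S) \<Longrightarrow> card X \<le> card S + d"
  shows "min_K12 G \<le> d"
proof -
  interpret pair_graph G by fact
  have E: "parcs G \<subseteq> pverts G \<times> pverts G" "sym (parcs G)" "irrefl (parcs G)"
    using G by (auto simp: pair_graph_iff)
  have N: "parcs G `` X \<subseteq> pverts G - X" if "independent_set G X" for X
    using that E(1) by (auto simp: independent_set_def)
  have "card X \<le> 2 * card (parcs G `` X) + 0" if X: "independent_set G X" for X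
  proof -
    have "card X \<le> num_isolated (delete_verts G (parcs G `` X))"
      by (rule card_le_num_isolated[OF G X])
    also have "\<dots> \<le> 2 * card (parcs G `` X)" using N[OF X] by (intro assms(2)) blast
    finally show ?thesis by simp
  qed
  then have "card J \<le> 2 * card (parcs G `` J)" if "J \<subseteq> pverts G" for J
    using card_le_neighbours[OF G _ _ that, of 2 0] by simp
  moreover have "card X \<le> 1 * card (parcs G `` X) + d" if X: "independent_set G X" for X
    using assms(3)[OF X N[OF X] card_le_num_isolated[OF G X]] by simp
  then have "card J \<le> card (parcs G `` J) + d" if "J \<subseteq> pverts G" for J
    using card_le_neighbours[OF G _ _ that, of 1 d] by simp
  ultimately obtain P where "matching P" "P \<subseteq> parcs G" "Domain P \<union> Range P = pverts G"
      "card (pverts G) \<le> card P + d"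
    using covering_matching_exists[OF pair_finite_verts E(1,2), of d] by metis
  then have "factorable (parcs G) (pverts G) d"
    using matching_factorable[OF pair_finite_verts E(2,3)] by blast
  then obtain F where "star_circuit_factor G F" "num_K12_components F \<le> d"
    using factorable_imp_factor[OF G] by blast
  then show ?thesis
    unfolding min_K12_def by (metis (mono_tags, lifting) Least_le order_trans)
qed

theorem corollary2p11:
  fixes G :: "'a pair_pre_digraph" and n m :: int
  assumes "pair_graph G"
    and "0 < n" and "n \<le> m" and "m \<le> 2 * n"
    and "\<And>S. S \<subseteq> pverts G \<Longrightarrow>
      real (num_isolated (delete_verts G S)) \<le> real_of_int m / real_of_int n * real (card S)"
  shows "real (min_K12 G) \<le> real_of_int (m - n) / real_of_int (m + n) * real (card (pverts G)) \<and>
    real (independence_number G) \<le> real_of_int m / real_of_int (m + n) * real (card (pverts G))"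
proof
  interpret pair_graph G by fact
  let ?V = "pverts G"
  have iso: "n * num_isolated (delete_verts G S) \<le> m * card S" if "S \<subseteq> ?V" for S
  proof -
    have "real_of_int (n * num_isolated (delete_verts G S)) \<le> real_of_int (m * card S)"
      using assms(5)[OF that] \<open>0 < n\<close> by (simp add: field_simps)
    then show ?thesis by (simp only: of_int_le_iff)
  qed
  define r where "r = real_of_int (m - n) / real_of_int (m + n) * real (card ?V)"
  \<comment> \<open>The deficiency must be a natural number; rounding down is harmless because
    \<open>card X - card S\<close> is an integer.\<close>
  define d where "d = nat \<lfloor>r\<rfloor>"
  have d: "card X \<le> card S + d"
    if X: "independent_set G X" and S: "S \<subseteq> ?V - X" and le: "card X \<le> num_isolated (delete_verts G S)"
    for X S
  proof -
    have "n * card X \<le> n * num_isolated (delete_verts G S)" using le \<open>0 < n\<close> by simp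
    also have "\<dots> \<le> m * card S" using S by (intro iso) auto
    finally have "n * card X \<le> m * card S" .
    \<comment> \<open>The left side minus the right side is twice
      \<open>n * card X - m * card S\<close>.\<close>
    then have "(m + n) * (int (card X) - card S) \<le> (m - n) * (card X + card S)"
      by (simp add: algebra_simps)
    also have "card X + card S = card (X \<union> S)"
      using X S pair_finite_verts
      by (intro card_Un_disjoint[symmetric]) (auto simp: independent_set_def intro: finite_subset)
    also have "(m - n) * card (X \<union> S) \<le> (m - n) * card ?V"
      using X S pair_finite_verts \<open>n \<le> m\<close>
      by (intro mult_left_mono) (auto simp: independent_set_def intro!: card_mono)
    finally have "real_of_int ((m + n) * (int (card X) - card S)) \<le> real_of_int ((m - n) * card ?V)"
      by (simp only: of_int_le_iff)
    then have "real_of_int (int (card X) - int (card S)) \<le> r"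
      using assms(2,3) unfolding r_def by (simp add: field_simps)
    then have "int (card X) - int (card S) \<le> \<lfloor>r\<rfloor>" by (simp only: le_floor_iff)
    then show ?thesis unfolding d_def by linarith
  qed
  have two: "num_isolated (delete_verts G S) \<le> 2 * card S" if "S \<subseteq> ?V" for S
  proof -
    have "n * num_isolated (delete_verts G S) \<le> m * card S" by (rule iso[OF that])
    also have "\<dots> \<le> (2 * n) * card S" using assms(4) by (intro mult_right_mono) auto
    finally have "n * int (num_isolated (delete_verts G S)) \<le> n * int (2 * card S)" by simp
    then show ?thesis using \<open>0 < n\<close> by simp
  qed
  have "min_K12 G \<le> d" using assms(1) two d by (rule min_K12_le)
  \<comment> \<open>Hence \<open>nat\<close> does not truncate the floor, and \<open>d\<close> is at
    most \<open>r\<close>.\<close>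
  moreover have "r \<ge> 0" using assms(2,3) by (simp add: r_def)
  ultimately have "real (min_K12 G) \<le> r" unfolding d_def by linarith
  then show "real (min_K12 G) \<le> real_of_int (m - n) / real_of_int (m + n) * real (card ?V)"
    by (simp add: r_def)

  have "finite {I. independent_set G I}"
    using pair_finite_verts by (auto simp: independent_set_def intro: finite_subset[of _ "Pow ?V"])
  then have "finite {card I |I. independent_set G I}" by (simp add: setcompr_eq_image)
  moreover have "independent_set G {}" by (simp add: independent_set_def)
  ultimately have "independence_number G \<in> {card I |I. independent_set G I}"
    unfolding independence_number_def by (intro Max_in) auto
  then obtain I where I: "independent_set G I" "independence_number G = card I" by blast
  \<comment> \<open>For (ii), delete the neighbourhood of a maximum independent set: all of
    \<open>I\<close> becomes isolated, and \<open>?N\<close> fits into the complement of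
    \<open>I\<close>.\<close>
  let ?N = "parcs G `` I"
  have N: "?N \<subseteq> ?V - I" using I(1) wellformed' by (auto simp: independent_set_def)
  have "n * card I \<le> n * num_isolated (delete_verts G ?N)"
    using card_le_num_isolated[OF assms(1) I(1)] \<open>0 < n\<close> by simp
  also have "\<dots> \<le> m * card ?N" using N by (intro iso) auto
  also have "\<dots> \<le> m * card (?V - I)"
    using N pair_finite_verts assms(2,3) by (intro mult_left_mono) (auto intro: card_mono)
  also have "int (card (?V - I)) = int (card ?V) - card I"
  proof -
    have "I \<subseteq> ?V" using I(1) by (simp add: independent_set_def)
    then show ?thesis
      using pair_finite_verts by (simp add: card_Diff_subset finite_subset card_mono of_nat_diff)
  qed
  finally have "(m + n) * card I \<le> m * card ?V" by (simp add: algebra_simps)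
  then have "real_of_int ((m + n) * card I) \<le> real_of_int (m * card ?V)"
    by (simp only: of_int_le_iff)
  then show "real (independence_number G) \<le> real_of_int m / real_of_int (m + n) * real (card ?V)"
    using assms(2,3) I(2) by (simp add: field_simps)
qed

end
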